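(* Let $\gamma=(p,q)$ with $p>0$, $q>0$. Let $f:I\times J\to\mathbb{R}$ be the bivariate fractal interpolation function (FIF) determined by the IFS $\{K,W_{ij}:(i,j)\in\Sigma_N\times\Sigma_M\}$, where $W_{ij}(x,y,z)=(u_i(x),v_j(y),\alpha z+q_{ij}(x,y))$. Then the mixed Riemann-Liouville fractional integral $I^{\gamma}f$ is the FIF associated with $\{K,\hat W_{ij}:(i,j)\in\Sigma_N\times\Sigma_M\}$, where $$\hat W_{ij}(x,y,z)=(u_i(x),v_j(y),\hat F_{ij}(x,y,z)),$$ and $\hat F_{ij}:K\to\mathbb{R}$ is defined by $\hat F_{ij}(x,y,z)=\alpha a_i^p c_j^q z+\hat q_{ij}(x,y)$ with $$\begin{aligned}\hat q_{ij}(x,y)=&\frac{1}{\Gamma(p)\,\Gamma(q)}\int_a^{u_i(x)}\int_c^{v_j(c)}(u_i(x)-s)^{p-1}(v_j(y)-t)^{q-1}f(s,t)\,ds\,dt\\&+\frac{c_j^q}{\Gamma(p)\,\Gamma(q)}\int_a^{u_i(a)}\int_c^{y}(u_i(x)-s)^{p-1}(y-t)^{q-1}f(s,v_j(t))\,ds\,dt\\&+\frac{a_i^pc_j^q}{\Gamma(p)\,\Gamma(q)}\int_a^{x}\int_c^{y}(x-s)^{p-1}(y-t)^{q-1}q_{ij}(s,t)\,ds\,dt,\end{aligned}$$ where in each double integral the first integral sign refers to $s$ and the second to $t$.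
   Context: Let $I=[a,b]$, $J=[c,d]$, $K=I\times J\times\mathbb{R}$. Interpolation data $\{(x_i,y_j,z_{ij})\in\mathbb{R}^3: i=0,\dots,N;\ j=0,\dots,M\}$ are given with $a=x_0<x_1<\dots<x_N=b$ and $c=y_0<y_1<\dots<y_M=d$. Write $\Sigma_N=\{1,\dots,N\}$, $\Sigma_{N,0}=\{0,\dots,N\}$, $\partial\Sigma_{N,0}=\{0,N\}$, $\mathrm{int}\,\Sigma_{N,0}=\{1,\dots,N-1\}$, and similarly with $M$. Put $I_i=[x_{i-1},x_i]$, $J_j=[y_{j-1},y_j]$. For $i\in\Sigma_N$, $u_i:I\to I_i$ is the contractive affine homeomorphism $u_i(x)=a_ix+b_i$ with $u_i(x_0)=x_{i-1},\ u_i(x_N)=x_i$ if $i$ is odd and $u_i(x_0)=x_i,\ u_i(x_N)=x_{i-1}$ if $i$ is even; thus $a_i=\frac{x_i-x_{i-1}}{x_N-x_0}$, $b_i=\frac{x_{i-1}x_N-x_ix_0}{x_N-x_0}$ for $i$ odd and $a_i=\frac{x_{i-1}-x_i}{x_N-x_0}$, $b_i=\frac{x_ix_N-x_{i-1}x_0}{x_N-x_0}$ for $i$ even. For $j\in\Sigma_M$, $v_j:J\to J_j$ is the contractive affine homeomorphism $v_j(y)=c_jy+d_j$ with $v_j(y_0)=y_{j-1},\ v_j(y_M)=y_j$ if $j$ is odd and $v_j(y_0)=y_j,\ v_j(y_M)=y_{j-1}$ if $j$ is even; thus $c_j=\frac{y_j-y_{j-1}}{y_M-y_0}$ for $j$ odd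 and $c_j=\frac{y_{j-1}-y_j}{y_M-y_0}$ for $j$ even (with corresponding $d_j$). Define $\rho(i,0)=i-1$, $\rho(i,N)=\rho(i,M)=i$ for $i$ odd and $\rho(i,0)=i$, $\rho(i,N)=\rho(i,M)=i-1$ for $i$ even. Let $\alpha$ be a real constant with $|\alpha|<1$, and for each $(i,j)\in\Sigma_N\times\Sigma_M$ let $q_{ij}:I\times J\to\mathbb{R}$ be continuous with $q_{ij}(x_k,y_l)=z_{\rho(i,k),\rho(j,l)}-\alpha z_{kl}$ for all $(k,l)\in\partial\Sigma_{N,0}\times\partial\Sigma_{M,0}$. Put $F_{ij}(x,y,z)=\alpha z+q_{ij}(x,y)$ on $K$ and $W_{ij}(x,y,z)=(u_i(x),v_j(y),F_{ij}(x,y,z))$. The $F_{ij}$ satisfy the matching conditions: (1) for $i\in\mathrm{int}\,\Sigma_{N,0}$, $j\in\Sigma_M$ and $x^*=u_i^{-1}(x_i)=u_{i+1}^{-1}(x_i)$, $F_{ij}(x^*,y,z)=F_{i+1,j}(x^*,y,z)$ for all $y\in J,z\in\mathbb{R}$; (2) for $i\in\Sigma_N$, $j\in\mathrm{int}\,\Sigma_{M,0}$ and $y^*=v_j^{-1}(y_j)=v_{j+1}^{-1}(y_j)$, $F_{ij}(x,y^*,z)=F_{i,j+1}(x,y^*,z)$ for all $x\in I,z\in\mathbb{R}$. The FIF determined by $\{K,W_{ij}\}$ is the unique continuous $f:I\times J\to\mathbb{R}$ with $f(x_i,y_j)=z_{ij}$ for all $(i,j)\in\Sigma_{N,0}\times\Sigma_{M,0}$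 whose graph $G=\{(x,y,f(x,y)):(x,y)\in I\times J\}$ satisfies $G=\bigcup_{(i,j)\in\Sigma_N\times\Sigma_M}W_{ij}(G)$. Equivalently, $f(u_i(x),v_j(y))=F_{ij}(x,y,f(x,y))$ for all $(x,y)\in I\times J$ and all $(i,j)$. A continuous function $g$ on $I\times J$ is said to be the FIF associated with another IFS $\{K,\hat W_{ij}\}$ of the same form in the same sense, the interpolation data being the values of $g$ at the grid points. For a function $f$ on $[a,b]\times[c,d]$ (assuming the integral exists), the mixed Riemann-Liouville fractional integral of order $\gamma=(p,q)$, $p>0$, $q>0$, is $$I^{\gamma}f(x,y)=\frac{1}{\Gamma(p)\,\Gamma(q)}\int_a^x\int_c^y(x-s)^{p-1}(y-t)^{q-1}f(s,t)\,ds\,dt,$$ where the outer limits $a,x$ refer to $s$ and the limits $c,y$ refer to $t$.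
   Formalization: For even i or j the numbers a_i, c_j and some of the integrands' bases are negative, so their non-integer powers are not real as written; such a power w^r is read as the real part of the principal complex power, i.e. cos(πr)|w|^r for w<0. *)

theory Defs
  imports "HOL-Analysis.Analysis"
begin

text \<open>
  A one-dimensional grid is a pair of a node function \<open>x\<close> and a number \<open>N\<close> of subintervals; the
  ambient interval is \<open>[x 0, x N]\<close>. The maps \<open>u\<^sub>i\<close> and \<open>v\<^sub>j\<close> are both given by \<open>node_map\<close>,
  for the two coordinate grids.
\<close>

definition grid :: "(nat \<Rightarrow> real) \<Rightarrow> nat \<Rightarrow> bool" where
  "grid x N \<longleftrightarrow> N \<ge> 1 \<and> strict_mono_on {0..N} x"

definition node_slope :: "(nat \<Rightarrow> real) \<Rightarrow> nat \<Rightarrow> nat \<Rightarrow> real" where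
  "node_slope x N i =
     (if odd i then (x i - x (i - 1)) / (x N - x 0) else (x (i - 1) - x i) / (x N - x 0))"

definition node_icpt :: "(nat \<Rightarrow> real) \<Rightarrow> nat \<Rightarrow> nat \<Rightarrow> real" where
  "node_icpt x N i =
     (if odd i then (x (i - 1) * x N - x i * x 0) / (x N - x 0)
      else (x i * x N - x (i - 1) * x 0) / (x N - x 0))"

definition node_map :: "(nat \<Rightarrow> real) \<Rightarrow> nat \<Rightarrow> nat \<Rightarrow> real \<Rightarrow> real" where
  "node_map x N i t = node_slope x N i * t + node_icpt x N i"

definition rect :: "(nat \<Rightarrow> real) \<Rightarrow> nat \<Rightarrow> (nat \<Rightarrow> real) \<Rightarrow> nat \<Rightarrow> (real \<times> real) set" where
  "rect x N y M = {x 0..x N} \<times> {y 0..y M}"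

text \<open>The second argument is always an endpoint index, i.e. \<open>0\<close> or the last index \<open>N\<close> resp. \<open>M\<close>.\<close>

definition rho :: "nat \<Rightarrow> nat \<Rightarrow> nat" where
  "rho i k = (if odd i then (if k = 0 then i - 1 else i) else (if k = 0 then i else i - 1))"

text \<open>
  An IFS has vertical maps \<open>F\<^sub>i\<^sub>j(s,t,w) = A\<^sub>i\<^sub>j w + Q\<^sub>i\<^sub>j(s,t)\<close>; the scalings \<open>A\<^sub>i\<^sub>j\<close> may depend on
  \<open>(i,j)\<close>, which is needed for the integrated system.
\<close>

definition vert_map ::
  "(nat \<Rightarrow> nat \<Rightarrow> real) \<Rightarrow> (nat \<Rightarrow> nat \<Rightarrow> real \<times> real \<Rightarrow> real) \<Rightarrow> nat \<Rightarrow> nat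
    \<Rightarrow> real \<Rightarrow> real \<Rightarrow> real \<Rightarrow> real" where
  "vert_map A Q i j s t w = A i j * w + Q i j (s, t)"

definition ifs_map ::
  "(nat \<Rightarrow> real) \<Rightarrow> nat \<Rightarrow> (nat \<Rightarrow> real) \<Rightarrow> nat
    \<Rightarrow> (nat \<Rightarrow> nat \<Rightarrow> real \<Rightarrow> real \<Rightarrow> real \<Rightarrow> real)
    \<Rightarrow> nat \<Rightarrow> nat \<Rightarrow> real \<times> real \<times> real \<Rightarrow> real \<times> real \<times> real" where
  "ifs_map x N y M F i j = (\<lambda>(s, t, w). (node_map x N i s, node_map y M j t, F i j s t w))"

definition fif_data ::
  "(nat \<Rightarrow> real) \<Rightarrow> nat \<Rightarrow> (nat \<Rightarrow> real) \<Rightarrow> nat \<Rightarrow> (nat \<Rightarrow> nat \<Rightarrow> real)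
    \<Rightarrow> (nat \<Rightarrow> nat \<Rightarrow> real) \<Rightarrow> (nat \<Rightarrow> nat \<Rightarrow> real \<times> real \<Rightarrow> real) \<Rightarrow> bool" where
  "fif_data x N y M z A Q \<longleftrightarrow>
     (\<forall>i\<in>{1..N}. \<forall>j\<in>{1..M}.
        \<bar>A i j\<bar> < 1 \<and> continuous_on (rect x N y M) (Q i j) \<and>
        (\<forall>k\<in>{0, N}. \<forall>l\<in>{0, M}. Q i j (x k, y l) = z (rho i k) (rho j l) - A i j * z k l))"

definition matching ::
  "(nat \<Rightarrow> real) \<Rightarrow> nat \<Rightarrow> (nat \<Rightarrow> real) \<Rightarrow> nat
    \<Rightarrow> (nat \<Rightarrow> nat \<Rightarrow> real \<Rightarrow> real \<Rightarrow> real \<Rightarrow> real) \<Rightarrow> bool" where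
  "matching x N y M F \<longleftrightarrow>
     (\<forall>i\<in>{1..N - 1}. \<forall>j\<in>{1..M}. \<forall>t\<in>{y 0..y M}. \<forall>w.
        let s = inv_into {x 0..x N} (node_map x N i) (x i) in F i j s t w = F (i + 1) j s t w) \<and>
     (\<forall>i\<in>{1..N}. \<forall>j\<in>{1..M - 1}. \<forall>s\<in>{x 0..x N}. \<forall>w.
        let t = inv_into {y 0..y M} (node_map y M j) (y j) in F i j s t w = F i (j + 1) s t w)"

definition surface ::
  "(nat \<Rightarrow> real) \<Rightarrow> nat \<Rightarrow> (nat \<Rightarrow> real) \<Rightarrow> nat \<Rightarrow> (real \<times> real \<Rightarrow> real)
    \<Rightarrow> (real \<times> real \<times> real) set" where
  "surface x N y M f = {(s, t, f (s, t)) | s t. (s, t) \<in> rect x N y M}"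

definition invariant_interpolant ::
  "(nat \<Rightarrow> real) \<Rightarrow> nat \<Rightarrow> (nat \<Rightarrow> real) \<Rightarrow> nat \<Rightarrow> (nat \<Rightarrow> nat \<Rightarrow> real)
    \<Rightarrow> (nat \<Rightarrow> nat \<Rightarrow> real \<times> real \<times> real \<Rightarrow> real \<times> real \<times> real)
    \<Rightarrow> (real \<times> real \<Rightarrow> real) \<Rightarrow> bool" where
  "invariant_interpolant x N y M z W f \<longleftrightarrow>
     continuous_on (rect x N y M) f \<and>
     (\<forall>i\<in>{0..N}. \<forall>j\<in>{0..M}. f (x i, y j) = z i j) \<and>
     surface x N y M f = (\<Union>i\<in>{1..N}. \<Union>j\<in>{1..M}. W i j ` surface x N y M f)"

definition is_FIF ::
  "(nat \<Rightarrow> real) \<Rightarrow> nat \<Rightarrow> (nat \<Rightarrow> real) \<Rightarrow> nat \<Rightarrow> (nat \<Rightarrow> nat \<Rightarrow> real)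
    \<Rightarrow> (nat \<Rightarrow> nat \<Rightarrow> real \<times> real \<times> real \<Rightarrow> real \<times> real \<times> real)
    \<Rightarrow> (real \<times> real \<Rightarrow> real) \<Rightarrow> bool" where
  "is_FIF x N y M z W f \<longleftrightarrow>
     invariant_interpolant x N y M z W f \<and>
     (\<forall>g. invariant_interpolant x N y M z W g \<longrightarrow> (\<forall>r\<in>rect x N y M. g r = f r))"

text \<open>Mixed Riemann--Liouville integral of order \<open>(p,q)\<close> with base point \<open>(a,c)\<close>.\<close>

definition RL_integral ::
  "real \<Rightarrow> real \<Rightarrow> real \<Rightarrow> real \<Rightarrow> (real \<times> real \<Rightarrow> real) \<Rightarrow> real \<times> real \<Rightarrow> real" where
  "RL_integral a c p q f = (\<lambda>(\<xi>, \<eta>).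
     1 / (Gamma p * Gamma q) *
     integral {a..\<xi>} (\<lambda>s. integral {c..\<eta>} (\<lambda>t.
       (\<xi> - s) powr (p - 1) * (\<eta> - t) powr (q - 1) * f (s, t))))"

text \<open>
  For even \<open>i\<close> the slope \<open>a\<^sub>i\<close> is negative, and so is \<open>u\<^sub>i(\<xi>) - s\<close> on part of \<open>[a, u\<^sub>i(a)]\<close>
  (likewise in the other coordinate), so powers of negative reals are needed. The real \<open>powr\<close>
  returns \<open>\<bar>w\<bar> powr r\<close> for \<open>w < 0\<close>, which is wrong already for \<open>r = 1\<close>. We take the real part of
  the principal complex power: it is the usual power whenever \<open>w \<ge> 0\<close>, or \<open>w < 0\<close> and \<open>r\<close> is an
  integer, it keeps the vertical maps real-valued, and it satisfies the laws
  \<open>(v w)^r = v^r w^r\<close> for \<open>v > 0\<close> and \<open>w^(r+1) = w w^r\<close>.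
\<close>

definition rpow :: "real \<Rightarrow> real \<Rightarrow> real" where
  "rpow w r = Re (complex_of_real w powr complex_of_real r)"

lemma rpow_nonneg: "w \<ge> 0 \<Longrightarrow> rpow w r = w powr r"
  by (simp add: rpow_def powr_of_real)

lemma rpow_neg: "w < 0 \<Longrightarrow> rpow w r = cos (pi * r) * (- w) powr r"
proof -
  assume w: "w < 0"
  have "Ln (complex_of_real w) = Complex (ln (- w)) pi"
    using w by (subst Ln_of_real') (auto simp: complex_eq_iff)
  then have "complex_of_real w powr complex_of_real r = exp (Complex (r * ln (- w)) (r * pi))"
    using w by (simp add: powr_def complex_of_real_mult_Complex)
  then show ?thesis
    using w by (simp add: rpow_def Re_exp powr_def[where 'a = real] mult.commute)
qed

lemma rpow_of_int: "w \<noteq> 0 \<Longrightarrow> rpow w (of_int n) = w powi n"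
proof -
  assume "w \<noteq> 0"
  then have "complex_of_real w powr of_int n = complex_of_real (w powi n)"
    by (simp add: complex_powr_of_int)
  then show ?thesis
    by (simp add: rpow_def del: of_real_power_int)
qed

lemma rpow_mult_pos:
  assumes "v > 0"
  shows "rpow (v * w) r = v powr r * rpow w r"
proof (cases "w < 0")
  case True
  have "rpow (v * w) r = cos (pi * r) * (v * - w) powr r"
    using assms True by (subst rpow_neg) (auto simp: mult_pos_neg)
  also have "(v * - w) powr r = v powr r * (- w) powr r"
    by (rule powr_mult)
  finally show ?thesis
    using True by (simp add: rpow_neg)
next
  case False
  then show ?thesis
    using assms by (simp add: rpow_nonneg powr_mult)
qed

lemma rpow_add_one:
  assumes "w \<noteq> 0"
  shows "rpow w (r + 1) = w * rpow w r"
proof (cases "w < 0")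
  case True
  have "(- w) powr (r + 1) = (- w) powr r * (- w)"
    using True by (simp add: powr_add)
  moreover have "cos (pi * (r + 1)) = - cos (pi * r)"
    by (simp add: distrib_left)
  ultimately show ?thesis
    using True by (simp add: rpow_neg)
next
  case False
  then show ?thesis
    using assms by (simp add: rpow_nonneg powr_add)
qed

text \<open>
  In the integrated system \<open>p\<close>, \<open>q\<close> are the orders of integration, \<open>f\<close> the given function and
  \<open>Q\<close> the family \<open>q\<^sub>i\<^sub>j\<close>.
\<close>

definition hat_scale ::
  "(nat \<Rightarrow> real) \<Rightarrow> nat \<Rightarrow> (nat \<Rightarrow> real) \<Rightarrow> nat \<Rightarrow> real \<Rightarrow> real \<Rightarrow> real
    \<Rightarrow> nat \<Rightarrow> nat \<Rightarrow> real" where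
  "hat_scale x N y M p q \<alpha> i j = \<alpha> * rpow (node_slope x N i) p * rpow (node_slope y M j) q"

definition hat_q ::
  "(nat \<Rightarrow> real) \<Rightarrow> nat \<Rightarrow> (nat \<Rightarrow> real) \<Rightarrow> nat \<Rightarrow> real \<Rightarrow> real
    \<Rightarrow> (real \<times> real \<Rightarrow> real) \<Rightarrow> (nat \<Rightarrow> nat \<Rightarrow> real \<times> real \<Rightarrow> real)
    \<Rightarrow> nat \<Rightarrow> nat \<Rightarrow> real \<times> real \<Rightarrow> real" where
  "hat_q x N y M p q f Q i j = (\<lambda>(\<xi>, \<eta>).
     let a = x 0; c = y 0; u = node_map x N i; v = node_map y M j;
         ai = node_slope x N i; cj = node_slope y M j
     in 1 / (Gamma p * Gamma q) *
          integral {a..u \<xi>} (\<lambda>s. integral {c..v c} (\<lambda>t.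
            rpow (u \<xi> - s) (p - 1) * rpow (v \<eta> - t) (q - 1) * f (s, t)))
      + rpow cj q / (Gamma p * Gamma q) *
          integral {a..u a} (\<lambda>s. integral {c..\<eta>} (\<lambda>t.
            rpow (u \<xi> - s) (p - 1) * rpow (\<eta> - t) (q - 1) * f (s, v t)))
      + rpow ai p * rpow cj q / (Gamma p * Gamma q) *
          integral {a..\<xi>} (\<lambda>s. integral {c..\<eta>} (\<lambda>t.
            rpow (\<xi> - s) (p - 1) * rpow (\<eta> - t) (q - 1) * Q i j (s, t))))"

end

theory Submission
  imports Defs
begin

text \<open>
  In one variable, \<open>[a, u(\<xi>)]\<close> is split at \<open>u(a)\<close> and \<open>s = u(\<sigma>)\<close> is substituted in the second
  part. If \<open>u\<close> has negative slope \<open>m\<close>, then \<open>u(\<xi>) \<le> u(a)\<close> and this is an oriented splitting; since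
  \<open>m\<close> times \<open>rpow m (p - 1)\<close> is \<open>rpow m p\<close>, both signs give the same formula. Applying it to the
  inner and then to the outer integral, and inserting the functional equation of \<open>f\<close>, yields
  \<open>g(u\<^sub>i \<xi>, v\<^sub>j \<eta>) = A\<^sub>i\<^sub>j g(\<xi>, \<eta>) + q\<^sub>i\<^sub>j(\<xi>, \<eta>)\<close> for \<open>g = I\<^sup>\<gamma> f\<close> and the hatted \<open>A\<close>, \<open>q\<close>. As \<open>g\<close> is
  continuous, this equation also gives continuity and the corner values of the hatted \<open>q\<^sub>i\<^sub>j\<close>.
\<close>

section \<open>Integrals against the one-variable kernel: integrability and linearity\<close>

text \<open>The singularity \<open>X\<close> is kept apart from the right end \<open>r\<close>,
  because the splitting produces the kernel of the point u(\<xi>) over an interval ending at u(a).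
  For negative slope \<open>X\<close> can lie inside that interval, and \<open>rpow\<close> then
  takes negative arguments.\<close>

definition kernel_integral :: "real \<Rightarrow> real \<Rightarrow> real \<Rightarrow> real \<Rightarrow> (real \<Rightarrow> real) \<Rightarrow> real" where
  "kernel_integral p X l r h = integral {l..r} (\<lambda>s. rpow (X - s) (p - 1) * h s)"

lemma rpow_0 [simp]: "rpow 0 r = 0"
  by (simp add: rpow_nonneg)

text \<open>The factor \<open>k\<close> will be a cosine or its absolute value, so that the kernel
  and its norm are covered together. Left of 0 the function is \<open>k\<close> times the reflection
  of \<open>s powr r\<close>, and \<open>r > -1\<close> makes the singularity integrable.\<close>

lemma two_sided_powr_integrable:
  fixes k r c :: real
  assumes r: "r > -1" and c: "c \<ge> 0"
  shows "(\<lambda>s. if s < 0 then k * (- s) powr r else s powr r) integrable_on {- c..c}"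
proof -
  have pos: "(\<lambda>s. s powr r) integrable_on {0..c}"
    by (rule integrable_on_powr_from_0[OF r c])
  have "(\<lambda>s. k * (- s) powr r) integrable_on {- c..0}"
    using integrable_on_cmult_left[OF pos, of k]
      Henstock_Kurzweil_Integration.integrable_reflect_real[where f = "\<lambda>s. k * s powr r" and a = 0 and b = c]
    by (simp del: integrable_on_cmult_left_iff Henstock_Kurzweil_Integration.integrable_reflect_real)
  then have "(\<lambda>s. if s < 0 then k * (- s) powr r else s powr r) integrable_on {- c..0}"
    by (rule integrable_spike_finite[of "{0}", rotated 2]) auto
  moreover have "(\<lambda>s. if s < 0 then k * (- s) powr r else s powr r) integrable_on {0..c}"
    by (rule integrable_eq[OF pos]) auto
  ultimately show ?thesis
    using c by (intro Henstock_Kurzweil_Integration.integrable_combine[of "- c" 0 c]) auto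
qed

lemma two_sided_powr_shift_integrable:
  fixes k r X l u :: real
  assumes r: "r > -1"
  shows "(\<lambda>s. if X < s then k * (s - X) powr r else (X - s) powr r) integrable_on {l..u}"
proof -
  \<comment> \<open>Large enough for \<open>{X - c..X + c}\<close>, the reflected and translated
    copy of \<open>{- c..c}\<close>, to contain \<open>{l..u}\<close>.\<close>
  define c where "c = \<bar>X\<bar> + \<bar>l\<bar> + \<bar>u\<bar>"
  let ?g = "\<lambda>s. if s < 0 then k * (- s) powr r else s powr r"
  have "?g integrable_on cbox (- c) c"
    using two_sided_powr_integrable[OF r, of c k] by (simp add: c_def)
  from integrable_affinity[OF this, of "-1" X]
  have "(\<lambda>s. ?g (X - s)) integrable_on (\<lambda>s. X - s) ` {- c..c}"
    by (simp only: scaleR_minus_left scaleR_one uminus_add_conv_diff cbox_interval)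
      (simp add: algebra_simps del: minus_diff_eq)
  moreover have "(\<lambda>s. X - s) ` {- c..c} = {X - c..X + c}"
    by (simp add: image_diff_atLeastAtMost)
  ultimately have "(\<lambda>s. ?g (X - s)) integrable_on {X - c..X + c}"
    by simp
  then have "(\<lambda>s. ?g (X - s)) integrable_on {l..u}"
    by (rule integrable_on_subinterval) (auto simp: c_def)
  then show ?thesis
    by (rule integrable_eq) auto
qed

text \<open>Mere integrability need not survive multiplication by a continuous function, nor does it
  supply a dominating function; absolute integrability does both.\<close>

lemma rpow_kernel_absolutely_integrable:
  assumes p: "p > 0"
  shows "(\<lambda>s. rpow (X - s) (p - 1)) absolutely_integrable_on {l..u}"
  unfolding absolutely_integrable_on_def
proof
  have r: "p - 1 > -1"
    using p by simp
  show "(\<lambda>s. rpow (X - s) (p - 1)) integrable_on {l..u}"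
    by (rule integrable_eq[OF two_sided_powr_shift_integrable[OF r, of X "cos (pi * (p - 1))"]])
      (auto simp: rpow_neg rpow_nonneg)
  show "(\<lambda>s. norm (rpow (X - s) (p - 1))) integrable_on {l..u}"
    by (rule integrable_eq[OF two_sided_powr_shift_integrable[OF r, of X "\<bar>cos (pi * (p - 1))\<bar>"]])
      (auto simp: rpow_neg rpow_nonneg abs_mult)
qed

lemma absolutely_integrable_times_continuous:
  fixes w h :: "real \<Rightarrow> real"
  assumes "w absolutely_integrable_on {l..r}" and "continuous_on {l..r} h"
  shows "(\<lambda>s. w s * h s) absolutely_integrable_on {l..r}"
proof -
  have "(\<lambda>s. h s * w s) absolutely_integrable_on {l..r}"
    using assms
    by (intro absolutely_integrable_bounded_measurable_product_real
        continuous_imp_measurable_on_sets_lebesgue compact_imp_bounded compact_continuous_image) auto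
  then show ?thesis
    by (simp add: mult.commute)
qed

lemma kernel_integrable:
  assumes "p > 0" and "continuous_on {l..r} h"
  shows "(\<lambda>s. rpow (X - s) (p - 1) * h s) integrable_on {l..r}"
  using absolutely_integrable_times_continuous[OF rpow_kernel_absolutely_integrable[OF assms(1)] assms(2)]
  by (simp add: absolutely_integrable_on_def)

lemma kernel_integral_cong:
  assumes "\<And>s. s \<in> {l..r} \<Longrightarrow> h s = h' s"
  shows "kernel_integral p X l r h = kernel_integral p X l r h'"
  unfolding kernel_integral_def using assms by (intro integral_cong) auto

lemma kernel_integral_cmult:
  "kernel_integral p X l r (\<lambda>s. C * h s) = C * kernel_integral p X l r h"
  unfolding kernel_integral_def by (subst integral_mult_right[symmetric]) (simp add: mult_ac)

lemma kernel_integral_add: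
  assumes "p > 0" and "continuous_on {l..r} h" and "continuous_on {l..r} h'"
  shows "kernel_integral p X l r (\<lambda>s. h s + h' s)
    = kernel_integral p X l r h + kernel_integral p X l r h'"
  unfolding kernel_integral_def distrib_left
  by (rule Henstock_Kurzweil_Integration.integral_add) (use assms in \<open>auto intro: kernel_integrable\<close>)

section \<open>Affine substitution in kernel integrals\<close>

text \<open>Integrating over the image set treats both orientations at once: the image is a closed
  interval either way, and the sign of \<open>m\<close> is left to the splitting of the
  interval.\<close>

lemma integral_affine_image:
  fixes F :: "real \<Rightarrow> real"
  assumes m: "m \<noteq> 0" and F: "F integrable_on (\<lambda>t. m * t + b) ` {e..\<xi>}"
  shows "integral ((\<lambda>t. m * t + b) ` {e..\<xi>}) F = \<bar>m\<bar> * integral {e..\<xi>} (\<lambda>t. F (m * t + b))"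
proof -
  obtain l r where lr: "(\<lambda>t. m * t + b) ` {e..\<xi>} = cbox l r"
    using interval_image_affinity_interval[of m b e \<xi>] by auto
  have "(F has_integral integral (cbox l r) F) (cbox l r)"
    using F lr by (simp add: has_integral_integral)
  from has_integral_affinity[OF this m, of b]
  have "((\<lambda>t. F (m * t + b)) has_integral (1 / \<bar>m\<bar>) * integral (cbox l r) F)
      ((\<lambda>t. (1 / m) * t + - ((1 / m) * b)) ` (\<lambda>t. m * t + b) ` {e..\<xi>})"
    by (simp add: lr)
  moreover have "(\<lambda>t. (1 / m) * t + - ((1 / m) * b)) ` (\<lambda>t. m * t + b) ` {e..\<xi>} = {e..\<xi>}"
    using m by (simp add: image_image field_simps)
  ultimately have "integral {e..\<xi>} (\<lambda>t. F (m * t + b)) = (1 / \<bar>m\<bar>) * integral (cbox l r) F"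
    by (simp add: integral_unique)
  then show ?thesis
    using m lr by simp
qed

text \<open>The substitution \<open>s = m * t + b\<close> turns the base of the kernel into
  \<open>m * (\<xi> - t)\<close>, which yields \<open>rpow m (p - 1)\<close>; the differential
  contributes one more \<open>m\<close>. The bound \<open>R\<close> exceeds both image points, since
  for \<open>m < 0\<close> the first integral on the right extends beyond the one on the
  left.\<close>

lemma kernel_integral_affine_split:
  assumes p: "p > 0" and m: "m \<noteq> 0" and e: "e \<le> \<xi>"
    and le: "l \<le> m * e + b" and l\<xi>: "l \<le> m * \<xi> + b"
    and eR: "m * e + b \<le> R" and \<xi>R: "m * \<xi> + b \<le> R"
    and h: "continuous_on {l..R} h"
  shows "kernel_integral p (m * \<xi> + b) l (m * \<xi> + b) h =
    kernel_integral p (m * \<xi> + b) l (m * e + b) h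
    + rpow m p * kernel_integral p \<xi> e \<xi> (\<lambda>s. h (m * s + b))"
proof -
  let ?u = "\<lambda>t. m * t + b"
  define P where "P = (\<lambda>s. rpow (?u \<xi> - s) (p - 1) * h s)"
  have int: "P integrable_on {l'..R'}" if "l \<le> l'" "R' \<le> R" for l' R'
    unfolding P_def
    using that by (intro kernel_integrable p continuous_on_subset[OF h]) auto
  \<comment> \<open>The positive factor for \<open>rpow_mult_pos\<close> is
    \<open>\<xi> - t\<close>, as \<open>m\<close> may be negative. At \<open>t = \<xi>\<close> both
    sides vanish because \<open>rpow 0 r\<close> is 0.\<close>
  have P_u: "P (?u t) = rpow m (p - 1) * (rpow (\<xi> - t) (p - 1) * h (?u t))" if "t \<in> {e..\<xi>}" for t
  proof (cases "t = \<xi>")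
    case False
    with that have "\<xi> - t > 0"
      by auto
    then have "rpow ((\<xi> - t) * m) (p - 1) = rpow (\<xi> - t) (p - 1) * rpow m (p - 1)"
      by (simp add: rpow_mult_pos rpow_nonneg)
    moreover have "?u \<xi> - ?u t = (\<xi> - t) * m"
      by (simp add: algebra_simps)
    ultimately show ?thesis
      by (simp add: P_def)
  qed (simp add: P_def)
  have tail: "integral (?u ` {e..\<xi>}) P
      = \<bar>m\<bar> * rpow m (p - 1) * kernel_integral p \<xi> e \<xi> (\<lambda>s. h (?u s))"
    if "P integrable_on ?u ` {e..\<xi>}"
  proof -
    have "integral {e..\<xi>} (\<lambda>t. P (?u t))
        = integral {e..\<xi>} (\<lambda>t. rpow m (p - 1) * (rpow (\<xi> - t) (p - 1) * h (?u t)))"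
      by (rule integral_cong) (rule P_u)
    then show ?thesis
      using integral_affine_image[OF m that] by (simp add: kernel_integral_def)
  qed
  have m_pow: "m * rpow m (p - 1) = rpow m p"
    using rpow_add_one[OF m, of "p - 1"] by simp
  have K: "kernel_integral p (?u \<xi>) l r h = integral {l..r} P" for r
    by (simp add: kernel_integral_def P_def)
  show ?thesis
  proof (cases "m > 0")
    case True
    then have "?u e \<le> ?u \<xi>"
      using e by simp
    then have "integral {l..?u \<xi>} P = integral {l..?u e} P + integral {?u e..?u \<xi>} P"
      using le \<xi>R int
      by (intro Henstock_Kurzweil_Integration.integral_combine[symmetric]) auto
    moreover have "?u ` {e..\<xi>} = {?u e..?u \<xi>}"
      using True e by (simp add: image_affinity_atLeastAtMost)
    ultimately show ?thesis
      using tail le \<xi>R int True m_pow by (simp add: K)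
  next
    case False
    then have neg: "m < 0"
      using m by simp
    then have "?u \<xi> \<le> ?u e"
      using e by simp
    \<comment> \<open>Now \<open>?u e\<close> is the right end, so the tail is subtracted from the
      integral up to \<open>?u e\<close>, and this sign turns \<open>\<bar>m\<bar>\<close> into
      \<open>m\<close>.\<close>
    then have "integral {l..?u e} P = integral {l..?u \<xi>} P + integral {?u \<xi>..?u e} P"
      using l\<xi> eR int
      by (intro Henstock_Kurzweil_Integration.integral_combine[symmetric]) auto
    moreover have "?u ` {e..\<xi>} = {?u \<xi>..?u e}"
      using neg e by (simp add: image_affinity_atLeastAtMost)
    ultimately show ?thesis
      using tail l\<xi> eR int neg m_pow by (simp add: K)
  qed
qed

text \<open>Moves the variable endpoint and the singularity of the kernel to the fixed point \<open>1\<close>, so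
  that continuity in the endpoint becomes continuity in a parameter of the integrand.\<close>

lemma kernel_integral_unit:
  assumes p: "p > 0" and X: "a \<le> X" and h: "continuous_on {a..X} h"
  shows "kernel_integral p X a X h
    = (X - a) powr p * kernel_integral p 1 0 1 (\<lambda>s. h ((X - a) * s + a))"
proof (cases "X = a")
  case True
  then show ?thesis
    by (simp add: kernel_integral_def)
next
  case False
  \<comment> \<open>The affine map sends 0 to \<open>a\<close>, so the first piece of the splitting
    is an integral over a single point.\<close>
  then show ?thesis
    using kernel_integral_affine_split[of p "X - a" 0 1 a a X h] assms
    by (simp add: kernel_integral_def rpow_nonneg)
qed

section \<open>Continuity in a parameter\<close>

text \<open>Dominated convergence along a sequence of parameters: \<open>\<phi>\<close> is bounded
  by some \<open>B\<close> on the compact product, so \<open>norm (w t) * B\<close> is a majorant.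
  The parameter space is an arbitrary metric space because it will be an interval, a rectangle, or a
  rectangle times an interval.\<close>

lemma continuous_on_weighted_integral:
  fixes w :: "real \<Rightarrow> real" and \<phi> :: "'a::metric_space \<times> real \<Rightarrow> real"
  assumes w: "w absolutely_integrable_on {l..r}" and K: "compact K"
    and \<phi>: "continuous_on (K \<times> {l..r}) \<phi>"
  shows "continuous_on K (\<lambda>k. integral {l..r} (\<lambda>t. w t * \<phi> (k, t)))"
  unfolding continuous_on_sequentially
proof (intro allI impI ballI, elim conjE)
  fix \<kappa> :: "nat \<Rightarrow> 'a" and k
  assume k: "k \<in> K" and \<kappa>: "\<forall>n. \<kappa> n \<in> K" and lim: "\<kappa> \<longlonglongrightarrow> k"
  have "bounded (\<phi> ` (K \<times> {l..r}))"
    using K \<phi> by (intro compact_imp_bounded compact_continuous_image compact_Times) auto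
  then obtain B where B: "\<And>v. v \<in> K \<times> {l..r} \<Longrightarrow> \<bar>\<phi> v\<bar> \<le> B"
    unfolding bounded_iff by auto
  have cont_t: "continuous_on {l..r} (\<lambda>t. \<phi> (k', t))" if "k' \<in> K" for k'
    by (rule continuous_on_compose2[OF \<phi>]) (use that in \<open>auto intro!: continuous_intros\<close>)
  have "(\<lambda>n. integral {l..r} (\<lambda>t. w t * \<phi> (\<kappa> n, t))) \<longlonglongrightarrow> integral {l..r} (\<lambda>t. w t * \<phi> (k, t))"
  proof (rule dominated_convergence)
    show "(\<lambda>t. w t * \<phi> (\<kappa> n, t)) integrable_on {l..r}" for n
      using absolutely_integrable_times_continuous[OF w cont_t] \<kappa>
      by (simp add: absolutely_integrable_on_def)
    have "(\<lambda>t. norm (w t)) integrable_on {l..r}"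
      using w by (simp add: absolutely_integrable_on_def)
    then show "(\<lambda>t. norm (w t) * B) integrable_on {l..r}"
      by (rule integrable_on_mult_left)
    show "norm (w t * \<phi> (\<kappa> n, t)) \<le> norm (w t) * B" if "t \<in> {l..r}" for n t
      using B[of "(\<kappa> n, t)"] \<kappa> that by (auto simp: abs_mult intro!: mult_left_mono)
    show "(\<lambda>n. w t * \<phi> (\<kappa> n, t)) \<longlonglongrightarrow> w t * \<phi> (k, t)" if t: "t \<in> {l..r}" for t
    proof -
      have "continuous_on K (\<lambda>k. \<phi> (k, t))"
        by (rule continuous_on_compose2[OF \<phi>]) (use t in \<open>auto intro!: continuous_intros\<close>)
      then have "(\<lambda>n. \<phi> (\<kappa> n, t)) \<longlonglongrightarrow> \<phi> (k, t)"
        using k \<kappa> lim unfolding continuous_on_sequentially by (auto simp: o_def)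
      then show ?thesis
        by (intro tendsto_intros)
    qed
  qed
  then show "((\<lambda>k. integral {l..r} (\<lambda>t. w t * \<phi> (k, t))) \<circ> \<kappa>) \<longlonglongrightarrow> integral {l..r} (\<lambda>t. w t * \<phi> (k, t))"
    by (simp add: o_def)
qed

lemma continuous_on_kernel_integral:
  fixes \<phi> :: "'a::metric_space \<times> real \<Rightarrow> real"
  assumes "p > 0" and "compact K" and "continuous_on (K \<times> {l..r}) \<phi>"
  shows "continuous_on K (\<lambda>k. kernel_integral p X l r (\<lambda>t. \<phi> (k, t)))"
  unfolding kernel_integral_def
  by (rule continuous_on_weighted_integral[OF rpow_kernel_absolutely_integrable[OF assms(1)] assms(2,3)])

section \<open>The double integrals as iterated kernel integrals\<close>

text \<open>\<open>powr\<close> and \<open>rpow\<close> agree here because both bases are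
  nonnegative on the domain of integration.\<close>

lemma RL_integral_eq:
  "RL_integral a c p q f (\<xi>, \<eta>) =
    1 / (Gamma p * Gamma q) * kernel_integral p \<xi> a \<xi> (\<lambda>s. kernel_integral q \<eta> c \<eta> (\<lambda>t. f (s, t)))"
proof -
  have "integral {c..\<eta>} (\<lambda>t. (\<xi> - s) powr (p - 1) * (\<eta> - t) powr (q - 1) * f (s, t))
      = rpow (\<xi> - s) (p - 1) * kernel_integral q \<eta> c \<eta> (\<lambda>t. f (s, t))" if "s \<in> {a..\<xi>}" for s
    unfolding kernel_integral_def using that
    by (simp only: integral_mult_right[symmetric])
      (auto intro!: integral_cong simp: rpow_nonneg mult.assoc)
  then show ?thesis
    unfolding RL_integral_def kernel_integral_def[of p]
    by (auto intro!: integral_cong arg_cong[where f = "\<lambda>v. _ * v"])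
qed

lemma iterated_rpow_integral:
  "integral {l..r} (\<lambda>s. integral {l'..r'} (\<lambda>t.
      rpow (X - s) (p - 1) * rpow (Y - t) (q - 1) * h s t))
    = kernel_integral p X l r (\<lambda>s. kernel_integral q Y l' r' (h s))"
  unfolding kernel_integral_def by (subst integral_mult_right[symmetric]) (simp add: mult.assoc)

lemma hat_q_eq:
  fixes x y :: "nat \<Rightarrow> real" and i j N M :: nat
  defines "u \<equiv> node_map x N i" and "v \<equiv> node_map y M j"
  shows "hat_q x N y M p q f Q i j (\<xi>, \<eta>) = 1 / (Gamma p * Gamma q) *
    (kernel_integral p (u \<xi>) (x 0) (u \<xi>) (\<lambda>s. kernel_integral q (v \<eta>) (y 0) (v (y 0)) (\<lambda>t. f (s, t)))
     + rpow (node_slope y M j) q *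
       kernel_integral p (u \<xi>) (x 0) (u (x 0)) (\<lambda>s. kernel_integral q \<eta> (y 0) \<eta> (\<lambda>t. f (s, v t)))
     + rpow (node_slope x N i) p * rpow (node_slope y M j) q *
       kernel_integral p \<xi> (x 0) \<xi> (\<lambda>s. kernel_integral q \<eta> (y 0) \<eta> (\<lambda>t. Q i j (s, t))))"
  unfolding hat_q_def u_def v_def Let_def case_prod_conv iterated_rpow_integral
  by (simp add: algebra_simps add_divide_distrib)

section \<open>Continuity of the mixed fractional integral\<close>

text \<open>Both variables are rescaled to the unit interval, after which the point (\<xi>, \<eta>)
  enters only through power factors and through the arguments of \<open>f\<close>.\<close>

lemma continuous_on_RL_integral:
  assumes p: "p > 0" and q: "q > 0" and f: "continuous_on ({a..b} \<times> {c..d}) f"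
  shows "continuous_on ({a..b} \<times> {c..d}) (RL_integral a c p q f)"
proof -
  let ?R = "{a..b} \<times> {c..d}"
  \<comment> \<open>The rescaled inner integral without its factor
    \<open>(\<eta> - c) powr q\<close>, as a function of the point \<open>r\<close> and the rescaled
    outer variable \<open>\<sigma>\<close>. Parameter continuity is applied first to the integral in
    \<open>\<tau>\<close>, then to that in \<open>\<sigma>\<close>.\<close>
  define \<Psi> where "\<Psi> = (\<lambda>(r, \<sigma>). kernel_integral q 1 0 1 (\<lambda>\<tau>.
    f ((fst r - a) * \<sigma> + a, (snd r - c) * \<tau> + c)))"
  have scale: "(w - l) * \<sigma> + l \<in> {l..r}" if "w \<in> {l..r}" "\<sigma> \<in> {0..1}" for w l r \<sigma> :: real
  proof -
    have "(w - l) * \<sigma> \<le> (w - l) * 1"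
      using that by (intro mult_left_mono) auto
    then show ?thesis
      using that by auto
  qed
  have "continuous_on ((?R \<times> {0..1}) \<times> {0..1})
      (\<lambda>((r, \<sigma>), \<tau>). f ((fst r - a) * \<sigma> + a, (snd r - c) * \<tau> + c))"
    unfolding case_prod_beta
    by (rule continuous_on_compose2[OF f])
      (use scale in \<open>auto intro!: continuous_intros simp del: atLeastAtMost_iff\<close>)
  from continuous_on_kernel_integral[OF q _ this, of 1]
  have "continuous_on (?R \<times> {0..1}) \<Psi>"
    unfolding \<Psi>_def by (simp add: compact_Times case_prod_beta)
  from continuous_on_kernel_integral[OF p _ this, of 1]
  have "continuous_on ?R (\<lambda>r. kernel_integral p 1 0 1 (\<lambda>\<sigma>. \<Psi> (r, \<sigma>)))"
    by (simp add: compact_Times)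
  then have "continuous_on ?R (\<lambda>r. 1 / (Gamma p * Gamma q) * ((fst r - a) powr p *
      ((snd r - c) powr q * kernel_integral p 1 0 1 (\<lambda>\<sigma>. \<Psi> (r, \<sigma>)))))"
    \<comment> \<open>Positive exponents keep the power factors continuous on the edges
      \<open>\<xi> = a\<close> and \<open>\<eta> = c\<close>, where their bases vanish.\<close>
    using p q by (intro continuous_intros continuous_on_powr') auto
  then show ?thesis
  proof (rule continuous_on_eq, clarify)
    fix \<xi> \<eta> assume \<xi>: "\<xi> \<in> {a..b}" and \<eta>: "\<eta> \<in> {c..d}"
    have f_sec: "continuous_on {c..\<eta>} (\<lambda>t. f (s, t))" if "s \<in> {a..b}" for s
      by (rule continuous_on_compose2[OF f]) (use that \<eta> in \<open>auto intro!: continuous_intros\<close>)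
    have "continuous_on ({a..\<xi>} \<times> {c..\<eta>}) f"
      by (rule continuous_on_subset[OF f]) (use \<xi> \<eta> in auto)
    from continuous_on_kernel_integral[OF q _ this]
    have inner: "continuous_on {a..\<xi>} (\<lambda>s. kernel_integral q \<eta> c \<eta> (\<lambda>t. f (s, t)))"
      by simp
    have "kernel_integral q \<eta> c \<eta> (\<lambda>t. f ((\<xi> - a) * \<sigma> + a, t))
        = (\<eta> - c) powr q * \<Psi> ((\<xi>, \<eta>), \<sigma>)" if "\<sigma> \<in> {0..1}" for \<sigma>
      using kernel_integral_unit[OF q _ f_sec, of "(\<xi> - a) * \<sigma> + a"] \<eta> scale[OF \<xi> that]
      by (simp add: \<Psi>_def)
    then have "kernel_integral p 1 0 1 (\<lambda>\<sigma>. kernel_integral q \<eta> c \<eta> (\<lambda>t. f ((\<xi> - a) * \<sigma> + a, t)))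
        = (\<eta> - c) powr q * kernel_integral p 1 0 1 (\<lambda>\<sigma>. \<Psi> ((\<xi>, \<eta>), \<sigma>))"
      by (subst kernel_integral_cmult[symmetric]) (rule kernel_integral_cong)
    then show "1 / (Gamma p * Gamma q) * ((fst (\<xi>, \<eta>) - a) powr p *
        ((snd (\<xi>, \<eta>) - c) powr q * kernel_integral p 1 0 1 (\<lambda>\<sigma>. \<Psi> ((\<xi>, \<eta>), \<sigma>))))
        = RL_integral a c p q f (\<xi>, \<eta>)"
      unfolding RL_integral_eq using kernel_integral_unit[OF p _ inner] \<xi> by simp
  qed
qed

section \<open>Grids and the coordinate maps\<close>

lemma grid_mono:
  assumes "grid x N" and "i \<le> j" and "j \<le> N"
  shows "x i \<le> x j"
  using assms strict_mono_on_leD[of "{0..N}" x i j] unfolding grid_def by auto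

lemma grid_less:
  assumes "grid x N" and "i < j" and "j \<le> N"
  shows "x i < x j"
  using assms strict_mono_onD[of "{0..N}" x i j] unfolding grid_def by auto

lemma node_map_endpoint:
  assumes g: "grid x N" and i: "i \<in> {1..N}" and k: "k \<in> {0, N}"
  shows "node_map x N i (x k) = x (rho i k)"
proof -
  \<comment> \<open>For \<open>N = 0\<close> the indices 0 and \<open>N\<close> would coincide, and
    \<open>rho\<close> could not tell the two endpoints apart.\<close>
  have "N > 0"
    using g by (simp add: grid_def)
  moreover have "x N - x 0 \<noteq> 0"
    using grid_less[OF g, of 0 N] \<open>N > 0\<close> by simp
  ultimately show ?thesis
    using k unfolding node_map_def node_slope_def node_icpt_def rho_def
    by (auto simp: divide_simps) (auto simp: algebra_simps)
qed

lemma node_slope_bounds: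
  assumes g: "grid x N" and i: "i \<in> {1..N}"
  shows "node_slope x N i \<noteq> 0" and "\<bar>node_slope x N i\<bar> \<le> 1"
proof -
  have "x (i - 1) < x i" "x 0 \<le> x (i - 1)" "x i \<le> x N"
    using i by (auto intro: grid_less[OF g] grid_mono[OF g])
  then show "node_slope x N i \<noteq> 0" "\<bar>node_slope x N i\<bar> \<le> 1"
    by (auto simp: node_slope_def abs_div divide_simps)
qed

lemma node_map_image:
  assumes g: "grid x N" and i: "i \<in> {1..N}"
  shows "node_map x N i ` {x 0..x N} = {x (i - 1)..x i}"
proof -
  have N: "N > 0"
    using g by (simp add: grid_def)
  have le: "x 0 \<le> x N"
    by (rule grid_mono[OF g]) auto
  have lt: "x (i - 1) < x i"
    using i by (intro grid_less[OF g]) auto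
  have pts: "node_slope x N i * x 0 + node_icpt x N i = x (rho i 0)"
      "node_slope x N i * x N + node_icpt x N i = x (rho i N)"
    using node_map_endpoint[OF g i] by (auto simp: node_map_def)
  have "x 0 < x N"
    using grid_less[OF g, of 0 N] N by simp
  \<comment> \<open>The image of an interval depends on the sign of the slope, the images of the
    endpoints on the parity of \<open>i\<close>; this links the two.\<close>
  then have "node_slope x N i \<ge> 0 \<longleftrightarrow> odd i"
    using lt by (auto simp: node_slope_def divide_simps)
  then show ?thesis
    using le pts N
    unfolding node_map_def[abs_def] image_affinity_atLeastAtMost
    by (auto simp: rho_def)
qed

lemma node_map_in:
  assumes g: "grid x N" and i: "i \<in> {1..N}" and s: "s \<in> {x 0..x N}"
  shows "node_map x N i s \<in> {x 0..x N}"
proof -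
  have "node_map x N i s \<in> {x (i - 1)..x i}"
    using node_map_image[OF g i] s by blast
  moreover have "x 0 \<le> x (i - 1)" "x i \<le> x N"
    using i by (auto intro: grid_mono[OF g])
  ultimately show ?thesis
    by auto
qed

lemma node_maps_cover:
  assumes g: "grid x N" and s: "s \<in> {x 0..x N}"
  obtains i s' where "i \<in> {1..N}" "s' \<in> {x 0..x N}" "s = node_map x N i s'"
proof -
  \<comment> \<open>The constraint \<open>i \<ge> 1\<close> puts \<open>s = x 0\<close> into the
    first subinterval; otherwise minimality supplies the lower bound
    \<open>x (i - 1)\<close>.\<close>
  define i where "i = (LEAST i. i \<ge> 1 \<and> s \<le> x i)"
  have N: "N \<ge> 1 \<and> s \<le> x N"
    using g s by (simp add: grid_def)
  have i: "i \<ge> 1 \<and> s \<le> x i"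
    unfolding i_def by (rule LeastI[of "\<lambda>i. i \<ge> 1 \<and> s \<le> x i", OF N])
  have "i \<le> N"
    unfolding i_def by (rule Least_le[of "\<lambda>i. i \<ge> 1 \<and> s \<le> x i", OF N])
  have "x (i - 1) \<le> s"
  proof (cases "i = 1")
    case True
    then show ?thesis
      using s by simp
  next
    case False
    then have "i - 1 \<ge> 1" "i - 1 < i"
      using i by auto
    then show ?thesis
      using not_less_Least[of "i - 1" "\<lambda>i. i \<ge> 1 \<and> s \<le> x i"] unfolding i_def[symmetric] by auto
  qed
  then have "s \<in> node_map x N i ` {x 0..x N}"
    using node_map_image[OF g, of i] i \<open>i \<le> N\<close> by auto
  then show thesis
    using i \<open>i \<le> N\<close> that by auto
qed

section \<open>Functional equation and uniqueness\<close>

text \<open>A point over a given base point lies on the graph only if its height is the value of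
  \<open>f\<close>, which gives the equation. Conversely, \<open>node_map_in\<close> keeps the
  images on the graph, and \<open>node_maps_cover\<close> provides a preimage for every graph
  point.\<close>

lemma surface_invariant_iff:
  assumes gx: "grid x N" and gy: "grid y M"
  shows "surface x N y M f
      = (\<Union>i\<in>{1..N}. \<Union>j\<in>{1..M}. ifs_map x N y M (vert_map A Q) i j ` surface x N y M f) \<longleftrightarrow>
    (\<forall>i\<in>{1..N}. \<forall>j\<in>{1..M}. \<forall>s\<in>{x 0..x N}. \<forall>t\<in>{y 0..y M}.
      f (node_map x N i s, node_map y M j t) = A i j * f (s, t) + Q i j (s, t))"
    (is "?S = ?U \<longleftrightarrow> ?E")
proof
  assume eq: "?S = ?U"
  show ?E
  proof (intro ballI)
    fix i j s t
    assume ij: "i \<in> {1..N}" "j \<in> {1..M}" and st: "s \<in> {x 0..x N}" "t \<in> {y 0..y M}"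
    have "(s, t, f (s, t)) \<in> ?S"
      using st by (auto simp: surface_def rect_def)
    then have "ifs_map x N y M (vert_map A Q) i j (s, t, f (s, t)) \<in> ?U"
      using ij by blast
    then have "ifs_map x N y M (vert_map A Q) i j (s, t, f (s, t)) \<in> ?S"
      by (rule ssubst[OF eq])
    then show "f (node_map x N i s, node_map y M j t) = A i j * f (s, t) + Q i j (s, t)"
      by (auto simp: surface_def ifs_map_def vert_map_def)
  qed
next
  assume E: ?E
  have step: "ifs_map x N y M (vert_map A Q) i j (s, t, f (s, t))
      = (node_map x N i s, node_map y M j t, f (node_map x N i s, node_map y M j t))"
    if "i \<in> {1..N}" "j \<in> {1..M}" "s \<in> {x 0..x N}" "t \<in> {y 0..y M}" for i j s t
    using E that by (simp add: ifs_map_def vert_map_def)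
  show "?S = ?U"
  proof (intro set_eqI iffI)
    fix w assume "w \<in> ?S"
    then obtain s t where w: "w = (s, t, f (s, t))" and st: "s \<in> {x 0..x N}" "t \<in> {y 0..y M}"
      by (auto simp: surface_def rect_def)
    obtain i s' where i: "i \<in> {1..N}" "s' \<in> {x 0..x N}" "s = node_map x N i s'"
      by (rule node_maps_cover[OF gx st(1)])
    obtain j t' where j: "j \<in> {1..M}" "t' \<in> {y 0..y M}" "t = node_map y M j t'"
      by (rule node_maps_cover[OF gy st(2)])
    have "(s', t', f (s', t')) \<in> ?S"
      using i j by (auto simp: surface_def rect_def)
    moreover have "w = ifs_map x N y M (vert_map A Q) i j (s', t', f (s', t'))"
      using step[OF i(1) j(1) i(2) j(2)] i j w by simp
    ultimately show "w \<in> ?U"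
      using i j by blast
  next
    fix w assume "w \<in> ?U"
    then obtain i j s t where ij: "i \<in> {1..N}" "j \<in> {1..M}"
      and st: "s \<in> {x 0..x N}" "t \<in> {y 0..y M}"
      and w: "w = ifs_map x N y M (vert_map A Q) i j (s, t, f (s, t))"
      by (auto simp: surface_def rect_def)
    then show "w \<in> ?S"
      using node_map_in[OF gx ij(1) st(1)] node_map_in[OF gy ij(2) st(2)]
      unfolding w step[OF ij st] surface_def rect_def by blast
  qed
qed

text \<open>Uniqueness: writing a maximum point of \<open>\<bar>h - g\<bar>\<close> as the image of \<open>(s', t')\<close> under
  \<open>(u\<^sub>i, v\<^sub>j)\<close>, the maximum is \<open>\<bar>A\<^sub>i\<^sub>j\<bar> < 1\<close> times the value at \<open>(s', t')\<close>, hence zero.\<close>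

lemma is_FIF_I:
  assumes gx: "grid x N" and gy: "grid y M"
    and A: "\<And>i j. i \<in> {1..N} \<Longrightarrow> j \<in> {1..M} \<Longrightarrow> \<bar>A i j\<bar> < 1"
    and cont: "continuous_on (rect x N y M) g"
    and val: "\<And>i j. i \<le> N \<Longrightarrow> j \<le> M \<Longrightarrow> g (x i, y j) = z i j"
    and eq: "\<And>i j s t. i \<in> {1..N} \<Longrightarrow> j \<in> {1..M} \<Longrightarrow> s \<in> {x 0..x N} \<Longrightarrow> t \<in> {y 0..y M} \<Longrightarrow>
      g (node_map x N i s, node_map y M j t) = A i j * g (s, t) + Q i j (s, t)"
  shows "is_FIF x N y M z (ifs_map x N y M (vert_map A Q)) g"
  unfolding is_FIF_def
proof (intro conjI allI impI ballI)
  show "invariant_interpolant x N y M z (ifs_map x N y M (vert_map A Q)) g"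
    unfolding invariant_interpolant_def surface_invariant_iff[OF gx gy]
    using cont val eq by auto
next
  fix h r
  assume h: "invariant_interpolant x N y M z (ifs_map x N y M (vert_map A Q)) h"
    and r: "r \<in> rect x N y M"
  have h_eq: "h (node_map x N i s, node_map y M j t) = A i j * h (s, t) + Q i j (s, t)"
    if "i \<in> {1..N}" "j \<in> {1..M}" "s \<in> {x 0..x N}" "t \<in> {y 0..y M}" for i j s t
    using h that unfolding invariant_interpolant_def surface_invariant_iff[OF gx gy] by blast
  have "continuous_on (rect x N y M) (\<lambda>r. \<bar>h r - g r\<bar>)"
    using h cont unfolding invariant_interpolant_def by (intro continuous_intros) auto
  moreover have "compact (rect x N y M)"
    by (simp add: rect_def compact_Times)
  ultimately obtain r0 where r0: "r0 \<in> rect x N y M"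
    and max: "\<And>r. r \<in> rect x N y M \<Longrightarrow> \<bar>h r - g r\<bar> \<le> \<bar>h r0 - g r0\<bar>"
    using continuous_attains_sup[of "rect x N y M" "\<lambda>r. \<bar>h r - g r\<bar>"] r by blast
  obtain s t where st: "r0 = (s, t)" "s \<in> {x 0..x N}" "t \<in> {y 0..y M}"
    using r0 by (auto simp: rect_def)
  obtain i s' where i: "i \<in> {1..N}" "s' \<in> {x 0..x N}" "s = node_map x N i s'"
    by (rule node_maps_cover[OF gx st(2)])
  obtain j t' where j: "j \<in> {1..M}" "t' \<in> {y 0..y M}" "t = node_map y M j t'"
    by (rule node_maps_cover[OF gy st(3)])
  have "h r0 - g r0 = A i j * (h (s', t') - g (s', t'))"
    using eq[OF i(1) j(1) i(2) j(2)] h_eq[OF i(1) j(1) i(2) j(2)] st i j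
    by (simp add: algebra_simps)
  moreover have "\<bar>h (s', t') - g (s', t')\<bar> \<le> \<bar>h r0 - g r0\<bar>"
    using i j by (intro max) (auto simp: rect_def)
  ultimately have "\<bar>h r0 - g r0\<bar> \<le> \<bar>A i j\<bar> * \<bar>h r0 - g r0\<bar>"
    by (metis abs_ge_zero abs_mult mult_left_mono)
  then have "(1 - \<bar>A i j\<bar>) * \<bar>h r0 - g r0\<bar> \<le> 0"
    by (simp add: algebra_simps)
  then have "\<bar>h r0 - g r0\<bar> \<le> 0"
    using A[OF i(1) j(1)] by (simp add: mult_le_0_iff)
  then show "h r = g r"
    using max[OF r] by simp
qed

section \<open>Contractivity and functional equation of the integrated system\<close>

text \<open>For negative \<open>w\<close> the real part of the complex power carries a cosine factor
  of modulus at most 1.\<close>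

lemma abs_rpow_le: "\<bar>rpow w r\<bar> \<le> \<bar>w\<bar> powr r"
proof (cases "w < 0")
  case True
  then show ?thesis
    by (simp add: rpow_neg abs_mult mult_left_le_one_le)
qed (simp add: rpow_nonneg)

text \<open>The slopes satisfy only a weak bound by 1, attained for a grid with one subinterval, so
  strictness comes from \<open>\<alpha>\<close>.\<close>

lemma hat_scale_abs_less_1:
  assumes gx: "grid x N" and gy: "grid y M" and "i \<in> {1..N}" and "j \<in> {1..M}"
    and \<alpha>: "\<bar>\<alpha>\<bar> < 1" and p: "p > 0" and q: "q > 0"
  shows "\<bar>hat_scale x N y M p q \<alpha> i j\<bar> < 1"
proof -
  have pow: "\<bar>rpow w r\<bar> \<le> 1" if "\<bar>w\<bar> \<le> 1" "r > 0" for w r :: real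
    using abs_rpow_le[of w r] powr_mono2[of r "\<bar>w\<bar>" 1] that by simp
  have "\<bar>rpow (node_slope x N i) p\<bar> * \<bar>rpow (node_slope y M j) q\<bar> \<le> 1 * 1"
    using node_slope_bounds[OF gx assms(3)] node_slope_bounds[OF gy assms(4)] p q
    by (intro mult_mono pow) auto
  then have "\<bar>\<alpha>\<bar> * (\<bar>rpow (node_slope x N i) p\<bar> * \<bar>rpow (node_slope y M j) q\<bar>) \<le> \<bar>\<alpha>\<bar> * 1"
    by (intro mult_left_mono) auto
  then show ?thesis
    using \<alpha> by (simp add: hat_scale_def abs_mult mult.assoc)
qed

text \<open>The inner integral is split at v(c) into \<open>H0 s + rpow n q * H s\<close>. The part
  with \<open>H0\<close> becomes the first term of \<open>hat_q\<close>. Splitting the outer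
  integral of \<open>H\<close> at u(a) gives the second term, and its substituted remainder gives
  the \<open>hat_scale\<close> term together with the third.\<close>

lemma RL_integral_node_map:
  assumes gx: "grid x N" and gy: "grid y M" and i: "i \<in> {1..N}" and j: "j \<in> {1..M}"
    and p: "p > 0" and q: "q > 0"
    and f: "continuous_on (rect x N y M) f" and Q: "continuous_on (rect x N y M) (Q i j)"
    and eq: "\<And>s t. s \<in> {x 0..x N} \<Longrightarrow> t \<in> {y 0..y M} \<Longrightarrow>
      f (node_map x N i s, node_map y M j t) = \<alpha> * f (s, t) + Q i j (s, t)"
    and \<xi>: "\<xi> \<in> {x 0..x N}" and \<eta>: "\<eta> \<in> {y 0..y M}"
  shows "RL_integral (x 0) (y 0) p q f (node_map x N i \<xi>, node_map y M j \<eta>)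
    = hat_scale x N y M p q \<alpha> i j * RL_integral (x 0) (y 0) p q f (\<xi>, \<eta>)
      + hat_q x N y M p q f Q i j (\<xi>, \<eta>)"
proof -
  define a c m n u v where "a = x 0" and "c = y 0" and "m = node_slope x N i"
    and "n = node_slope y M j" and "u = node_map x N i" and "v = node_map y M j"
  define H0 where "H0 = (\<lambda>s. kernel_integral q (v \<eta>) c (v c) (\<lambda>t. f (s, t)))"
  define H where "H = (\<lambda>s. kernel_integral q \<eta> c \<eta> (\<lambda>t. f (s, v t)))"
  have u: "u s = m * s + node_icpt x N i" for s
    by (simp add: u_def m_def node_map_def)
  have v: "v t = n * t + node_icpt y M j" for t
    by (simp add: v_def n_def node_map_def)
  have ac: "a \<in> {x 0..x N}" "c \<in> {y 0..y M}"
    using \<xi> \<eta> by (auto simp: a_def c_def)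
  have u_in: "u s \<in> {a..x N}" if "s \<in> {x 0..x N}" for s
    using node_map_in[OF gx i that] by (simp add: u_def a_def)
  have v_in: "v t \<in> {c..y M}" if "t \<in> {y 0..y M}" for t
    using node_map_in[OF gy j that] by (simp add: v_def c_def)
  have f': "continuous_on ({a..x N} \<times> {c..y M}) f"
    and Q': "continuous_on ({a..x N} \<times> {c..y M}) (Q i j)"
    using f Q by (simp_all add: rect_def a_def c_def)
  have sec: "continuous_on {c..y M} (\<lambda>t. g (s, t))"
    if "continuous_on ({a..x N} \<times> {c..y M}) g" "s \<in> {a..x N}" for g :: "real \<times> real \<Rightarrow> real" and s
    by (rule continuous_on_compose2[OF that(1)]) (use that(2) in \<open>auto intro!: continuous_intros\<close>)
  have H0: "continuous_on {a..x N} H0"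
    unfolding H0_def
    by (rule continuous_on_kernel_integral[OF q compact_Icc continuous_on_subset[OF f']])
      (use v_in[OF ac(2)] in auto)
  have "continuous_on ({a..x N} \<times> {c..\<eta>}) (\<lambda>(s, t). f (s, v t))"
    unfolding case_prod_beta
  proof (rule continuous_on_compose2[OF f'])
    show "continuous_on ({a..x N} \<times> {c..\<eta>}) (\<lambda>r. (fst r, v (snd r)))"
      unfolding v by (intro continuous_intros)
    show "(\<lambda>r. (fst r, v (snd r))) ` ({a..x N} \<times> {c..\<eta>}) \<subseteq> {a..x N} \<times> {c..y M}"
      using v_in \<eta> by (auto simp: c_def simp del: atLeastAtMost_iff) auto
  qed
  from continuous_on_kernel_integral[OF q _ this]
  have H: "continuous_on {a..x N} H"
    by (simp add: H_def)
  have inner: "kernel_integral q (v \<eta>) c (v \<eta>) (\<lambda>t. f (s, t)) = H0 s + rpow n q * H s"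
    if "s \<in> {a..x N}" for s
    using kernel_integral_affine_split[OF q _ _ _ _ _ _ sec[OF f' that], of n c \<eta> "node_icpt y M j"]
      node_slope_bounds[OF gy j] v_in[OF ac(2)] v_in[OF \<eta>] \<eta>
    by (simp add: H0_def H_def v n_def c_def)
  \<comment> \<open>Only with both arguments substituted does \<open>f (u s, v t)\<close> appear, to
    which the functional equation applies.\<close>
  have H_u: "H (u s) = \<alpha> * kernel_integral q \<eta> c \<eta> (\<lambda>t. f (s, t))
      + kernel_integral q \<eta> c \<eta> (\<lambda>t. Q i j (s, t))" if s: "s \<in> {a..x N}" for s
  proof -
    have c1: "continuous_on {c..\<eta>} (\<lambda>t. f (s, t))" "continuous_on {c..\<eta>} (\<lambda>t. Q i j (s, t))"
      by (rule continuous_on_subset[OF sec[OF _ s]]; use f' Q' \<eta> in auto)+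
    have "H (u s) = kernel_integral q \<eta> c \<eta> (\<lambda>t. \<alpha> * f (s, t) + Q i j (s, t))"
      unfolding H_def u_def v_def using s \<eta>
      by (intro kernel_integral_cong eq) (auto simp: a_def c_def)
    also have "\<dots> = kernel_integral q \<eta> c \<eta> (\<lambda>t. \<alpha> * f (s, t))
        + kernel_integral q \<eta> c \<eta> (\<lambda>t. Q i j (s, t))"
      using c1 by (intro kernel_integral_add q continuous_intros)
    finally show ?thesis
      by (simp add: kernel_integral_cmult)
  qed
  have cont_inner: "continuous_on {a..\<xi>} (\<lambda>s. kernel_integral q \<eta> c \<eta> (\<lambda>t. g (s, t)))"
    if "continuous_on ({a..x N} \<times> {c..y M}) g" for g
    by (rule continuous_on_kernel_integral[OF q compact_Icc continuous_on_subset[OF that]])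
      (use \<xi> \<eta> in auto)
  have "kernel_integral p (u \<xi>) a (u \<xi>) (\<lambda>s. kernel_integral q (v \<eta>) c (v \<eta>) (\<lambda>t. f (s, t)))
      = kernel_integral p (u \<xi>) a (u \<xi>) (\<lambda>s. H0 s + rpow n q * H s)"
    using u_in[OF \<xi>] by (intro kernel_integral_cong inner) auto
  also have "\<dots> = kernel_integral p (u \<xi>) a (u \<xi>) H0
      + kernel_integral p (u \<xi>) a (u \<xi>) (\<lambda>s. rpow n q * H s)"
    by (intro kernel_integral_add p continuous_intros continuous_on_subset[OF H0]
        continuous_on_subset[OF H]) (use u_in[OF \<xi>] in auto)
  \<comment> \<open>Only \<open>H\<close> is split in the outer variable; the integral of
    \<open>H0\<close> stays on \<open>{a..u \<xi>}\<close>, as in the first term of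
    \<open>hat_q\<close>.\<close>
  also have "kernel_integral p (u \<xi>) a (u \<xi>) (\<lambda>s. rpow n q * H s)
      = rpow n q * (kernel_integral p (u \<xi>) a (u a) H
          + rpow m p * kernel_integral p \<xi> a \<xi> (\<lambda>s. H (u s)))"
    using kernel_integral_affine_split[OF p _ _ _ _ _ _ H, of m a \<xi> "node_icpt x N i"]
      node_slope_bounds[OF gx i] u_in[OF ac(1)] u_in[OF \<xi>] \<xi>
    by (simp add: kernel_integral_cmult u m_def a_def)
  also have "kernel_integral p \<xi> a \<xi> (\<lambda>s. H (u s))
      = kernel_integral p \<xi> a \<xi> (\<lambda>s. \<alpha> * kernel_integral q \<eta> c \<eta> (\<lambda>t. f (s, t))
          + kernel_integral q \<eta> c \<eta> (\<lambda>t. Q i j (s, t)))"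
    using \<xi> by (intro kernel_integral_cong H_u) auto
  also have "\<dots> = \<alpha> * kernel_integral p \<xi> a \<xi> (\<lambda>s. kernel_integral q \<eta> c \<eta> (\<lambda>t. f (s, t)))
      + kernel_integral p \<xi> a \<xi> (\<lambda>s. kernel_integral q \<eta> c \<eta> (\<lambda>t. Q i j (s, t)))"
    using cont_inner[OF f'] cont_inner[OF Q']
    by (subst kernel_integral_add) (auto simp: kernel_integral_cmult intro!: p continuous_intros)
  finally show ?thesis
    unfolding RL_integral_eq hat_q_eq hat_scale_def H0_def H_def u_def v_def a_def c_def m_def n_def
    by (simp add: algebra_simps add_divide_distrib)
qed

section \<open>The fractional integral as interpolation function\<close>

theorem theorem5p3:
  fixes x y :: "nat \<Rightarrow> real" and N M :: nat
    and z :: "nat \<Rightarrow> nat \<Rightarrow> real"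
    and \<alpha> p q :: real
    and Q :: "nat \<Rightarrow> nat \<Rightarrow> real \<times> real \<Rightarrow> real"
    and f :: "real \<times> real \<Rightarrow> real"
  assumes "grid x N" and "grid y M"
    and "\<bar>\<alpha>\<bar> < 1"
    and "fif_data x N y M z (\<lambda>i j. \<alpha>) Q"
    and "matching x N y M (vert_map (\<lambda>i j. \<alpha>) Q)"
    and "is_FIF x N y M z (ifs_map x N y M (vert_map (\<lambda>i j. \<alpha>) Q)) f"
    and "p > 0" and "q > 0"
  defines "g \<equiv> RL_integral (x 0) (y 0) p q f"
    and "zg \<equiv> \<lambda>i j. RL_integral (x 0) (y 0) p q f (x i, y j)"
    and "Ahat \<equiv> hat_scale x N y M p q \<alpha>"
    and "Qhat \<equiv> hat_q x N y M p q f Q"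
  shows "fif_data x N y M zg Ahat Qhat \<and>
    is_FIF x N y M zg (ifs_map x N y M (vert_map Ahat Qhat)) g"
proof -
  have f_cont: "continuous_on (rect x N y M) f"
    and f_eq: "\<And>i j s t. i \<in> {1..N} \<Longrightarrow> j \<in> {1..M} \<Longrightarrow> s \<in> {x 0..x N} \<Longrightarrow> t \<in> {y 0..y M} \<Longrightarrow>
      f (node_map x N i s, node_map y M j t) = \<alpha> * f (s, t) + Q i j (s, t)"
    using assms(6) unfolding is_FIF_def invariant_interpolant_def
      surface_invariant_iff[OF assms(1,2)] by blast+
  have Q_cont: "continuous_on (rect x N y M) (Q i j)" if "i \<in> {1..N}" "j \<in> {1..M}" for i j
    using assms(4) that unfolding fif_data_def by blast
  have g_cont: "continuous_on (rect x N y M) g"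
    using continuous_on_RL_integral[OF assms(7,8)] f_cont by (simp add: g_def rect_def)
  have g_eq: "g (node_map x N i s, node_map y M j t) = Ahat i j * g (s, t) + Qhat i j (s, t)"
    if "i \<in> {1..N}" "j \<in> {1..M}" "s \<in> {x 0..x N}" "t \<in> {y 0..y M}" for i j s t
    unfolding g_def Ahat_def Qhat_def
    using that by (intro RL_integral_node_map assms f_cont Q_cont f_eq)
  have A_less: "\<bar>Ahat i j\<bar> < 1" if "i \<in> {1..N}" "j \<in> {1..M}" for i j
    unfolding Ahat_def using that by (intro hat_scale_abs_less_1 assms)
  have zg: "zg i j = g (x i, y j)" for i j
    by (simp add: zg_def g_def)
  have "fif_data x N y M zg Ahat Qhat"
    unfolding fif_data_def
  proof (intro ballI conjI)
    fix i j assume ij: "i \<in> {1..N}" "j \<in> {1..M}"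
    show "\<bar>Ahat i j\<bar> < 1"
      by (rule A_less[OF ij])
    have "continuous_on (rect x N y M) (\<lambda>r. g (node_map x N i (fst r), node_map y M j (snd r)))"
      by (rule continuous_on_compose2[OF g_cont])
        (use node_map_in[OF assms(1) ij(1)] node_map_in[OF assms(2) ij(2)] in
          \<open>auto intro!: continuous_intros simp: rect_def node_map_def\<close>)
    then have "continuous_on (rect x N y M)
        (\<lambda>r. g (node_map x N i (fst r), node_map y M j (snd r)) - Ahat i j * g r)"
      by (intro continuous_intros g_cont)
    then show "continuous_on (rect x N y M) (Qhat i j)"
      by (rule continuous_on_eq) (auto simp: rect_def g_eq[OF ij])
    fix k l assume kl: "k \<in> {0, N}" "l \<in> {0, M}"
    have "x k \<in> {x 0..x N}" "y l \<in> {y 0..y M}"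
      using kl by (auto intro: grid_mono[OF assms(1)] grid_mono[OF assms(2)])
    \<comment> \<open>The coordinate maps send this corner to the grid point with indices
      \<open>rho i k\<close> and \<open>rho j l\<close>, so the functional equation at the corner is
      the required interpolation condition.\<close>
    from g_eq[OF ij this]
    show "Qhat i j (x k, y l) = zg (rho i k) (rho j l) - Ahat i j * zg k l"
      unfolding zg node_map_endpoint[OF assms(1) ij(1) kl(1)]
        node_map_endpoint[OF assms(2) ij(2) kl(2)] by simp
  qed
  moreover have "is_FIF x N y M zg (ifs_map x N y M (vert_map Ahat Qhat)) g"
    by (rule is_FIF_I[OF assms(1,2) A_less g_cont zg[symmetric] g_eq])
  ultimately show ?thesis
    by blast
qed

end
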